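(* Let $G=(V,E)$ be a graph and let $n\ge 3$ be an integer. Then every size-$n$ subgraph of $G$ can be obtained by joining a size-$(n-2)$ subgraph of $G$ with a size-$3$ subgraph of $G$ on a common vertex, both in the vertex-induced and in the edge-induced setting. Explicitly: (i) (vertex-induced) For every $W\subseteq V$ with $|W|=n$ such that the induced subgraph $G[W]$ is connected, there exist $A,B\subseteq W$ with $|A|=n-2$, $|B|=3$, $A\cup B=W$, $|A\cap B|=1$, such that $G[A]$ and $G[B]$ are connected; thus $G[W]$ is the vertex-induced join of $G[A]$ and $G[B]$. (ii) (edge-induced) For every connected (not necessarily induced) subgraph $H$ of $G$ with $n$ vertices, there exist connected subgraphs $S$ and $T$ of $G$ with $|V(S)|=n-2$, $|V(T)|=3$, $|V(S)\cap V(T)|=1$, and a set $F$ of edges of $G$, each having one endpoint in $V(S)\setminus V(T)$ and the other in $V(T)\setminus V(S)$, such that $V(H)=V(S)\cup V(T)$ and $E(H)=E(S)\cup E(T)\cup F$.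
   Context: Graphs are undirected and simple; vertices and edges may carry labels, which subgraphs inherit and which play no role in this statement. A size-$k$ subgraph of $G$ is a connected subgraph of $G$ with exactly $k$ vertices (so the size-$3$ subgraphs are wedges, i.e. paths on three vertices, and triangles). For $W\subseteq V$, $G[W]$ denotes the subgraph of $G$ with vertex set $W$ and all edges of $G$ between vertices of $W$. Two subgraphs $S$ and $T$ of $G$ can be joined on a common vertex if they share exactly one vertex. In the vertex-induced setting, the subgraphs considered are the connected induced subgraphs, and the join of $S$ and $T$ has vertex set $V(S)\cup V(T)$ and edge set consisting of $E(S)\cup E(T)$ together with all edges of $G$ connecting a vertex of $S$ with a vertex of $T$. In the edge-induced setting, the subgraphs considered are arbitrary connected subgraphs, and joining $S$ and $T$ produces one result for each subset $F$ of the edges of $G$ connecting $V(S)\setminus V(T)$ with $V(T)\setminus V(S)$, namely the subgraph with vertex set $V(S)\cup V(T)$ and edge set $E(S)\cup E(T)\cup F$. *)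

theory Defs
  imports Main
begin

datatype 'a graph = Graph (verts: "'a set") (edges: "'a set set")

text \<open>Undirected edges are two-element sets of vertices, which excludes loops and
  parallel edges. The vertex set may be infinite.\<close>
definition simple_graph :: "'a graph \<Rightarrow> bool" where
  "simple_graph G \<longleftrightarrow> (\<forall>e\<in>edges G. e \<subseteq> verts G \<and> card e = 2)"

definition adj_rel :: "'a graph \<Rightarrow> 'a rel" where
  "adj_rel G = {(u, v). {u, v} \<in> edges G}"

definition connected_graph :: "'a graph \<Rightarrow> bool" where
  "connected_graph G \<longleftrightarrow>
     verts G \<noteq> {} \<and> (\<forall>u\<in>verts G. \<forall>v\<in>verts G. (u, v) \<in> (adj_rel G)\<^sup>*)"

definition subgraph :: "'a graph \<Rightarrow> 'a graph \<Rightarrow> bool" where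
  "subgraph H G \<longleftrightarrow> simple_graph H \<and> verts H \<subseteq> verts G \<and> edges H \<subseteq> edges G"

definition subgraph_of_size :: "'a graph \<Rightarrow> nat \<Rightarrow> 'a graph \<Rightarrow> bool" where
  "subgraph_of_size G k H \<longleftrightarrow>
     subgraph H G \<and> connected_graph H \<and> finite (verts H) \<and> card (verts H) = k"

text \<open>Meant for \<open>W \<subseteq> verts G\<close>.\<close>
definition induced :: "'a graph \<Rightarrow> 'a set \<Rightarrow> 'a graph" where
  "induced G W = Graph W {e \<in> edges G. e \<subseteq> W}"

definition edges_between :: "'a graph \<Rightarrow> 'a set \<Rightarrow> 'a set \<Rightarrow> 'a set set" where
  "edges_between G A B = {e \<in> edges G. \<exists>a\<in>A. \<exists>b\<in>B. e = {a, b}}"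

definition vertex_induced_join :: "'a graph \<Rightarrow> 'a graph \<Rightarrow> 'a graph \<Rightarrow> 'a graph" where
  "vertex_induced_join G S T =
     Graph (verts S \<union> verts T) (edges S \<union> edges T \<union> edges_between G (verts S) (verts T))"

end

(* Layer a connected graph by the distance to a root r and let v be a vertex of maximal distance
  with predecessor p. If p has another neighbour w in the last layer, split off {p, v, w}
  at p. Otherwise p is not the root and has a predecessor q; split off {q, p, v} at q, which leaves
  every other vertex with a predecessor. *)

theory Submission imports Defs begin

section \<open>Connectedness and distance layerings\<close>

lemma verts_induced [simp]: "verts (induced G W) = W"
  by (simp add: induced_def)

text \<open>Descending along \<open>f\<close> inside \<open>A\<close> can only stop at
  \<open>r\<close>, so every vertex of \<open>A\<close> is linked to \<open>r\<close>. Here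
  \<open>r\<close> may differ from the root of the layering: for a three-vertex piece it is the
  vertex at which that piece is split off.\<close>

lemma connected_induced_if_descending:
  fixes f :: "'a \<Rightarrow> nat"
  assumes r: "r \<in> A"
    and desc: "\<And>v. v \<in> A \<Longrightarrow> v \<noteq> r \<Longrightarrow> \<exists>u\<in>A. {u, v} \<in> edges G \<and> f u < f v"
  shows "connected_graph (induced G A)"
proof -
  let ?R = "adj_rel (induced G A)"
  have "sym ?R"
    by (auto simp: sym_def adj_rel_def insert_commute)
  then have sym: "sym (?R\<^sup>*)"
    by (rule sym_rtrancl)
  have to_root: "(r, v) \<in> ?R\<^sup>*" if "v \<in> A" for v
    using that
  proof (induction "f v" arbitrary: v rule: less_induct)
    case less
    show ?case
    proof (cases "v = r")
      case False
      then obtain u where u: "u \<in> A" "{u, v} \<in> edges G" "f u < f v"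
        using desc less.prems by blast
      moreover have "(u, v) \<in> ?R"
        using u less.prems by (simp add: adj_rel_def induced_def)
      ultimately show ?thesis
        using less.hyps by (meson rtrancl.rtrancl_into_rtrancl)
    qed simp
  qed
  show ?thesis
    unfolding connected_graph_def
  proof (intro conjI ballI)
    show "verts (induced G A) \<noteq> {}"
      using r by auto
    fix u v
    assume "u \<in> verts (induced G A)" "v \<in> verts (induced G A)"
    then have "(r, u) \<in> ?R\<^sup>*" "(r, v) \<in> ?R\<^sup>*"
      using to_root by auto
    then show "(u, v) \<in> ?R\<^sup>*"
      using sym by (meson rtrancl_trans symD)
  qed
qed

text \<open>Take \<open>f\<close> to be the length of a shortest walk from \<open>r\<close>; the
  last vertex before \<open>v\<close> on such a walk is exactly one layer closer to
  \<open>r\<close>.\<close>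

lemma ex_distance_layering:
  assumes "simple_graph H" "connected_graph H" "r \<in> verts H"
  obtains f :: "'a \<Rightarrow> nat"
  where "f r = 0"
    "\<And>v. v \<in> verts H \<Longrightarrow> v \<noteq> r \<Longrightarrow> \<exists>u\<in>verts H. {u, v} \<in> edges H \<and> f v = Suc (f u)"
proof (rule that[of "\<lambda>v. LEAST k. (r, v) \<in> adj_rel H ^^ k"])
  let ?R = "adj_rel H"
  let ?f = "\<lambda>v. LEAST k. (r, v) \<in> ?R ^^ k"
  show "?f r = 0"
    by (rule Least_eq_0) simp
  fix v
  assume v: "v \<in> verts H" "v \<noteq> r"
  then have "(r, v) \<in> ?R\<^sup>*"
    using assms by (auto simp: connected_graph_def)
  then have "\<exists>k. (r, v) \<in> ?R ^^ k"
    by (simp add: rtrancl_power)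
  then have fv: "(r, v) \<in> ?R ^^ ?f v"
    by (rule LeastI_ex)
  \<comment> \<open>The zeroth power of a relation is the identity, so \<open>v \<noteq> r\<close>
    forces a positive distance and hence a last step of the walk.\<close>
  then obtain k where k: "?f v = Suc k"
    using v by (cases "?f v") auto
  then obtain u where u: "(r, u) \<in> ?R ^^ k" "(u, v) \<in> ?R"
    using fv by auto
  have "?f u \<le> k"
    using u(1) by (rule Least_le)
  \<comment> \<open>A shortest walk to \<open>u\<close>, extended by the edge to \<open>v\<close>,
    bounds \<open>?f v\<close> from above; \<open>?f u \<le> k\<close> gives the opposite
    bound.\<close>
  moreover have "(r, u) \<in> ?R ^^ ?f u"
    using u(1) by (rule LeastI)
  then have "(r, v) \<in> ?R ^^ Suc (?f u)"
    using u by auto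
  then have "?f v \<le> Suc (?f u)"
    by (rule Least_le)
  moreover have "{u, v} \<in> edges H"
    using u by (simp add: adj_rel_def)
  moreover from this have "u \<in> verts H"
    using assms by (auto simp: simple_graph_def)
  ultimately show "\<exists>u\<in>verts H. {u, v} \<in> edges H \<and> ?f v = Suc (?f u)"
    using k \<open>?f u \<le> k\<close> by auto
qed

section \<open>Splitting off three vertices\<close>

text \<open>The pieces are induced in \<open>H\<close> itself, so the lemma serves both settings:
  \<open>H\<close> becomes \<open>induced G W\<close> in the first and an arbitrary connected
  subgraph in the second.\<close>

lemma split_off_size_3:
  assumes H: "simple_graph H" "connected_graph H" and card: "card (verts H) \<ge> 3"
  obtains A B where "A \<union> B = verts H" "card A = card (verts H) - 2" "card B = 3"
    "card (A \<inter> B) = 1" "connected_graph (induced H A)" "connected_graph (induced H B)"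
proof -
  note result = that
  define V where "V = verts H"
  \<comment> \<open>An infinite set has \<open>card\<close> 0, so the size bound gives
    finiteness.\<close>
  have fin: "finite V"
    using card by (simp add: V_def card_ge_0_finite)
  obtain r where r: "r \<in> V"
    using H by (auto simp: connected_graph_def V_def)
  obtain f :: "'a \<Rightarrow> nat" where f_r: "f r = 0" and pred:
    "\<And>v. v \<in> V \<Longrightarrow> v \<noteq> r \<Longrightarrow> \<exists>u\<in>V. {u, v} \<in> edges H \<and> f v = Suc (f u)"
    using ex_distance_layering H r unfolding V_def by metis
  have root: "u = r" if "u \<in> V" "f u = 0" for u
    using pred[of u] that by auto
  have outside: "\<exists>w\<in>V. w \<notin> X" if "finite X" "card X \<le> 2" for X
    using that card card_mono[of X V] unfolding V_def by fastforce
  have "\<exists>w\<in>V. w \<notin> {r}"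
    by (rule outside) auto
  then obtain s where s: "s \<in> V" "s \<noteq> r"
    by blast
  have "Max (f ` V) \<in> f ` V"
    using fin r by (intro Max_in) auto
  then obtain v where v: "v \<in> V" and v_eq: "f v = Max (f ` V)"
    by (metis imageE)
  have max: "f w \<le> f v" if "w \<in> V" for w
    using fin that by (simp add: v_eq)
  have "f v > 0"
    using pred[OF s] max[of s] s by auto
  then have "v \<noteq> r"
    using f_r by auto
  then obtain p where p: "p \<in> V" "{p, v} \<in> edges H" "f v = Suc (f p)"
    using pred v by blast
  \<comment> \<open>Bookkeeping common to both cases: \<open>x\<close> is the shared vertex and
    \<open>y\<close>, \<open>z\<close> leave the large piece, so only connectedness remains to be
    checked.\<close>
  have finish: thesis
    if xyz: "x \<in> V" "y \<in> V" "z \<in> V" "x \<noteq> y" "x \<noteq> z" "y \<noteq> z"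
      and conn: "connected_graph (induced H (V - {y, z}))" "connected_graph (induced H {x, y, z})"
    for x y z
  proof (rule result[OF _ _ _ _ conn])
    show "(V - {y, z}) \<union> {x, y, z} = verts H"
      using xyz by (auto simp: V_def)
    show "card (V - {y, z}) = card (verts H) - 2"
      using xyz fin by (simp add: card_Diff_subset V_def)
    show "card {x, y, z} = 3"
      using xyz by simp
    have "(V - {y, z}) \<inter> {x, y, z} = {x}"
      using xyz by auto
    then show "card ((V - {y, z}) \<inter> {x, y, z}) = 1"
      by simp
  qed
  show thesis
  proof (cases "\<exists>w\<in>V. w \<noteq> v \<and> f w = f v \<and> {p, w} \<in> edges H")
    case True
    then obtain w where w: "w \<in> V" "w \<noteq> v" "f w = f v" "{p, w} \<in> edges H"
      by blast
    show thesis
    proof (rule finish[of p v w])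
      show "connected_graph (induced H (V - {v, w}))"
      proof (rule connected_induced_if_descending[where r = r and f = f])
        show "r \<in> V - {v, w}"
          using r f_r w \<open>f v > 0\<close> by auto
        fix a
        assume a: "a \<in> V - {v, w}" "a \<noteq> r"
        then obtain u where "u \<in> V" "{u, a} \<in> edges H" "f a = Suc (f u)"
          using pred by blast
        \<comment> \<open>Thus \<open>u\<close> lies strictly below the last layer, which contains
          both \<open>v\<close> and \<open>w\<close>, and survives their removal.\<close>
        moreover have "f a \<le> f v"
          using a max by simp
        ultimately show "\<exists>u\<in>V - {v, w}. {u, a} \<in> edges H \<and> f u < f a"
          using w by (intro bexI[of _ u]) auto
      qed
      show "connected_graph (induced H {p, v, w})"
        by (rule connected_induced_if_descending[where r = p and f = f]) (use p w in auto)
    qed (use v p w in auto)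
  next
    case False
    \<comment> \<open>Otherwise the last layer is layer 1, and any third vertex lies in it and is
      adjacent to \<open>p\<close>, contrary to the case assumption.\<close>
    have "p \<noteq> r"
    proof
      assume pr: "p = r"
      have "\<exists>w\<in>V. w \<notin> {r, v}"
        by (rule outside) (auto simp: card_insert_if)
      then obtain w where w: "w \<in> V" "w \<noteq> r" "w \<noteq> v"
        by blast
      then obtain u where u: "u \<in> V" "{u, w} \<in> edges H" "f w = Suc (f u)"
        using pred by blast
      then have "f u = 0"
        using max[of w] w p pr f_r by simp
      then show False
        using False root[of u] u w p pr f_r by auto
    qed
    then obtain q where q: "q \<in> V" "{q, p} \<in> edges H" "f p = Suc (f q)"
      using pred p by blast
    show thesis
    proof (rule finish[of q p v])
      show "connected_graph (induced H (V - {p, v}))"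
      proof (rule connected_induced_if_descending[where r = r and f = f])
        show "r \<in> V - {p, v}"
          using r \<open>p \<noteq> r\<close> \<open>v \<noteq> r\<close> by auto
        fix a
        assume a: "a \<in> V - {p, v}" "a \<noteq> r"
        then obtain u where u: "u \<in> V" "{u, a} \<in> edges H" "f a = Suc (f u)"
          using pred by blast
        \<comment> \<open>A vertex with predecessor \<open>v\<close> would lie beyond the last
          layer.\<close>
        have "u \<noteq> v"
          using a u max[of a] by auto
        \<comment> \<open>A vertex with predecessor \<open>p\<close> lies in the layer of
          \<open>v\<close>; by the case assumption it is \<open>v\<close> itself.\<close>
        moreover have "u \<noteq> p"
          using a u p False by auto
        ultimately show "\<exists>u\<in>V - {p, v}. {u, a} \<in> edges H \<and> f u < f a"
          using u by (intro bexI[of _ u]) auto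
      qed
      show "connected_graph (induced H {q, p, v})"
        by (rule connected_induced_if_descending[where r = q and f = f]) (use p q in auto)
    qed (use v p q in auto)
  qed
qed

section \<open>Edges of the pieces and joins\<close>

text \<open>An edge contained in neither \<open>A\<close> nor \<open>B\<close> has one endpoint only
  in \<open>A\<close> and the other only in \<open>B\<close>. These crossing edges provide the set
  \<open>F\<close> of the edge-induced setting.\<close>

lemma edges_cover:
  assumes "simple_graph H" "A \<union> B = verts H"
  shows "edges H = edges (induced H A) \<union> edges (induced H B) \<union> edges_between H (A - B) (B - A)"
proof -
  have "e \<subseteq> A \<or> e \<subseteq> B \<or> (\<exists>a\<in>A - B. \<exists>b\<in>B - A. e = {a, b})" if e: "e \<in> edges H" for e
  proof -
    have "e \<subseteq> A \<union> B" "card e = 2"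
      using assms e by (auto simp: simple_graph_def)
    moreover from this obtain x y where "e = {x, y}"
      by (auto simp: card_2_iff)
    ultimately consider "e \<subseteq> A" | "e \<subseteq> B" | "x \<in> A - B" "y \<in> B - A" | "y \<in> A - B" "x \<in> B - A"
      by blast
    then show ?thesis
      by cases (use \<open>e = {x, y}\<close> in \<open>auto simp: doubleton_eq_iff\<close>)
  qed
  then show ?thesis
    unfolding induced_def edges_between_def graph.sel by blast
qed

lemma simple_induced: "simple_graph G \<Longrightarrow> simple_graph (induced G W)"
  by (auto simp: simple_graph_def induced_def)

lemma induced_induced: "A \<subseteq> W \<Longrightarrow> induced (induced G W) A = induced G A"
  by (auto simp: induced_def)

text \<open>The join takes all edges of \<open>G\<close> between \<open>A\<close> and
  \<open>B\<close>, including those at common vertices. They still lie inside \<open>W\<close>, so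
  they add nothing beyond the edges of \<open>induced G W\<close>.\<close>

lemma induced_eq_vertex_induced_join:
  assumes "simple_graph G" "A \<union> B = W"
  shows "induced G W = vertex_induced_join G (induced G A) (induced G B)"
proof -
  have "edges (induced G W) = edges (induced G A) \<union> edges (induced G B) \<union>
      edges_between (induced G W) (A - B) (B - A)"
    using edges_cover[of "induced G W" A B] simple_induced[OF assms(1)]
      induced_induced[of A W] induced_induced[of B W] assms(2) by force
  moreover have "edges_between (induced G W) (A - B) (B - A) \<subseteq> edges_between G A B"
    by (auto simp: edges_between_def induced_def)
  moreover have "edges_between G A B \<subseteq> edges (induced G W)"
    using assms by (auto simp: edges_between_def induced_def)
  ultimately have "edges (induced G W) = edges (induced G A) \<union> edges (induced G B) \<union>
      edges_between G A B"
    by blast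
  then show ?thesis
    using assms by (intro graph.expand) (simp add: vertex_induced_join_def)
qed

lemma subgraph_of_size_induced:
  assumes "subgraph H G" "A \<subseteq> verts H" "finite A" "connected_graph (induced H A)"
  shows "subgraph_of_size G (card A) (induced H A)"
  using assms by (auto simp: subgraph_of_size_def subgraph_def simple_induced)
    (auto simp: induced_def)

theorem theorem1:
  fixes G :: "'a graph" and n :: nat
  assumes "simple_graph G" and "n \<ge> 3"
  shows "(\<forall>W. W \<subseteq> verts G \<and> card W = n \<and> connected_graph (induced G W) \<longrightarrow>
            (\<exists>A B. A \<subseteq> W \<and> B \<subseteq> W \<and> card A = n - 2 \<and> card B = 3 \<and>
               A \<union> B = W \<and> card (A \<inter> B) = 1 \<and>
               connected_graph (induced G A) \<and> connected_graph (induced G B) \<and>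
               induced G W = vertex_induced_join G (induced G A) (induced G B))) \<and>
         (\<forall>H. subgraph_of_size G n H \<longrightarrow>
            (\<exists>S T F. subgraph_of_size G (n - 2) S \<and> subgraph_of_size G 3 T \<and>
               card (verts S \<inter> verts T) = 1 \<and>
               F \<subseteq> edges_between G (verts S - verts T) (verts T - verts S) \<and>
               verts H = verts S \<union> verts T \<and> edges H = edges S \<union> edges T \<union> F))"
proof (intro conjI allI impI)
  fix W
  assume W: "W \<subseteq> verts G \<and> card W = n \<and> connected_graph (induced G W)"
  \<comment> \<open>Nested induced subgraphs collapse because \<open>A\<close> and \<open>B\<close>
    lie in \<open>W\<close>.\<close>
  obtain A B where AB: "A \<union> B = W" "card A = n - 2" "card B = 3" "card (A \<inter> B) = 1"
    "connected_graph (induced (induced G W) A)" "connected_graph (induced (induced G W) B)"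
    using split_off_size_3[of "induced G W"] W assms by (auto simp: simple_induced)
  then have "A \<subseteq> W" "B \<subseteq> W"
    by auto
  with AB have "connected_graph (induced G A)" "connected_graph (induced G B)"
    by (simp_all only: induced_induced)
  with \<open>A \<subseteq> W\<close> \<open>B \<subseteq> W\<close> AB(1-4) induced_eq_vertex_induced_join[OF assms(1) AB(1)]
  show "\<exists>A B. A \<subseteq> W \<and> B \<subseteq> W \<and> card A = n - 2 \<and> card B = 3 \<and>
      A \<union> B = W \<and> card (A \<inter> B) = 1 \<and>
      connected_graph (induced G A) \<and> connected_graph (induced G B) \<and>
      induced G W = vertex_induced_join G (induced G A) (induced G B)"
    by blast
next
  fix H
  assume "subgraph_of_size G n H"
  then have H: "subgraph H G" "simple_graph H" "connected_graph H" "finite (verts H)"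
    "card (verts H) = n"
    by (auto simp: subgraph_of_size_def subgraph_def)
  obtain A B where AB: "A \<union> B = verts H" "card A = n - 2" "card B = 3" "card (A \<inter> B) = 1"
    "connected_graph (induced H A)" "connected_graph (induced H B)"
    using split_off_size_3[of H] H assms by auto
  \<comment> \<open>Inducing in \<open>H\<close> rather than in \<open>G\<close> keeps out edges of
    \<open>G\<close> that are missing from \<open>H\<close>; \<open>?F\<close> likewise collects
    only crossing edges of \<open>H\<close>.\<close>
  let ?S = "induced H A" and ?T = "induced H B" and ?F = "edges_between H (A - B) (B - A)"
  have "A \<subseteq> verts H" "B \<subseteq> verts H" "finite A" "finite B"
    using AB(1) H(4) by (auto intro: finite_subset)
  then have "subgraph_of_size G (n - 2) (induced H A)" "subgraph_of_size G 3 (induced H B)"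
    using subgraph_of_size_induced[OF H(1)] AB by metis+
  moreover have "edges_between H (A - B) (B - A) \<subseteq> edges_between G (A - B) (B - A)"
    using H by (auto simp: edges_between_def subgraph_def)
  ultimately have "subgraph_of_size G (n - 2) ?S \<and> subgraph_of_size G 3 ?T \<and>
      card (verts ?S \<inter> verts ?T) = 1 \<and>
      ?F \<subseteq> edges_between G (verts ?S - verts ?T) (verts ?T - verts ?S) \<and>
      verts H = verts ?S \<union> verts ?T \<and> edges H = edges ?S \<union> edges ?T \<union> ?F"
    using AB edges_cover[OF H(2) AB(1)] by simp
  then show "\<exists>S T F. subgraph_of_size G (n - 2) S \<and> subgraph_of_size G 3 T \<and>
      card (verts S \<inter> verts T) = 1 \<and>
      F \<subseteq> edges_between G (verts S - verts T) (verts T - verts S) \<and>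
      verts H = verts S \<union> verts T \<and> edges H = edges S \<union> edges T \<union> F"
    by blast
qed

end
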